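(* Let $0\le\beta_0<\beta_1\le\infty$. Assume that for every $t\in(\beta_0,\beta_1)$ there exist a decomposition $S=\bigcup_{i\in I}S_t^i$ into finitely many disjoint sets with $\mu_t(S_t^i)>0$, and non-negative definite quadratic forms $\mathcal E_t^i$ ($i\in I$) on functions on $S$, such that for some fixed finite constant $K$ $$\sum_{i\in I}\mu_t(S_t^i)\,\mathcal E_t^i(f,f)\le K\,\mathcal E_t(f,f)\qquad\forall\,t\in(\beta_0,\beta_1),\ f:S\to\mathbb R.$$ Assume further that for all $t\in(\beta_0,\beta_1)$ and $i\in I$ the following local Poincaré type inequalities hold with constants $A_t^i,B_t^i\in(0,\infty)$: for all $f:S\to\mathbb R$ with $\mathbb E_t[f|\pi]=0$, $$\mathbb E_t^i[-\tilde H_t f^2]\le A_t^i\,\mathcal E_t^i(f,f),\qquad \big|\mathbb E_t^i[\tilde H_t f]\big|^2\le B_t^i\,\mathcal E_t^i(f,f).$$ Set $\hat A_t:=K\max_iA_t^i$ and $\hat B_t:=K\max_iB_t^i$. Let $\nu\in\mathcal M_1(S)$, $\nu_t=\Phi_{0,t}\nu$, $g_t=\nu_t/\mu_t$, $\varepsilon_t=\mathbb E_t[(g_t-1)^2]$. If $M_t>\hat A_t/2$ for all $t\in(\beta_0,\beta_1)$, then (for $t\in(\beta_0,\beta_1)$) $$\frac{d}{dt}\log\varepsilon_t\le\frac{\hat B_t}{M_t-\hat A_t/2}\,(1+\varepsilon_t)+\big(1+\sqrt{\varepsilon_t}\big)^2\max_{i\in I}h_t^-(i),$$ where $$h_t(i):=\mathbb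 E_t^i[H]-\mathbb E_t[H]=-\frac{\partial}{\partial s}\log\mu_s(S_t^i)\Big|_{s=t}\qquad(i\in I).$$
   Context: $S$ is a finite set, $\mathcal M_1(S)$ is the set of probability measures on $S$, $\mu\in\mathcal M_1(S)$ satisfies $\mu(x)>0$ for all $x\in S$, and $H:S\to[0,\infty)$. For $t\ge 0$, $\mu_t(x)=Z_t^{-1}e^{-tH(x)}\mu(x)$ with $Z_t=\sum_{x}e^{-tH(x)}\mu(x)$; $\mathbb E_t$ denotes expectation with respect to $\mu_t$. $a^-:=\max(-a,0)$. For each $t\ge0$, $\mathcal L_t=(\mathcal L_t(x,y))_{x,y\in S}$ is a generator ($Q$-matrix: nonnegative off-diagonal entries, rows summing to $0$), depending continuously on $t$, satisfying detailed balance $\mu_t(x)\mathcal L_t(x,y)=\mu_t(y)\mathcal L_t(y,x)$ for all $x,y$; $(\mathcal L_tg)(x)=\sum_y\mathcal L_t(x,y)g(y)$. The Dirichlet form is $\mathcal E_t(f,g)=\frac12\sum_{x,y}(f(y)-f(x))(g(y)-g(x))\mathcal L_t(x,y)\mu_t(x)$. The constants $M_t\ge0$ ($t\ge0$) depend continuously on $t$. $p_{s,t}$ ($0\le s\le t$) is the unique matrix solution of $\frac{\partial}{\partial t}p_{s,t}f=p_{s,t}(M_t\mathcal L_tf-Hf)$, $p_{s,s}f=f$ for all $f:S\to\mathbb R$. The nonlinear semigroup on $\mathcal M_1(S)$ is $\Phi_{s,t}\nu:=\dfrac{\nu p_{s,t}}{(\nu p_{s,t})(S)}$, where $(\nu p)(y)=\sum_x\nu(x)p(x,y)$.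 Given the decomposition $(S_t^i)_{i\in I}$, $\pi:S\to I$ is the natural projection, $\mathbb E_t^i$ is expectation with respect to the conditional measure $\mu_t(\,\cdot\,|S_t^i)$; $\mathbb E_t[f|\pi]:=\sum_{i\in I}\mathbb E_t^i[f]\,\chi_{S_t^i}$, where $\chi_A$ is the indicator function of $A$; and $\tilde H_t:=H-\mathbb E_t[H|\pi]$. An example of admissible forms is $\mathcal E_t^i(f,f)=\frac12\sum_{x,y\in S_t^i}(f(y)-f(x))^2\mathcal L_t(x,y)\mu_t(x|S_t^i)$, for which the comparison with $\mathcal E_t$ holds with $K=1$.
   Formalization: The formal theorem additionally assumes K ≥ 0 and that each form E_t^i vanishes on functions constant on every block S_t^j (true for forms on functions on S_t^i); for arbitrary quadratic forms on functions on S, or for K < 0, the stated bound fails. *)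

theory Defs
  imports "HOL-Analysis.Analysis"
begin

text \<open>
  The finite set is the universe of a type \<open>'s\<close> of class \<open>finite\<close>.  Functions on it and (mass
  functions of) measures on it are vectors in \<open>real ^ 's\<close>, and kernels are matrices: \<open>Q *v f\<close> is
  the action on functions, \<open>\<nu> v* Q\<close> the action on measures.  The product \<open>f * g\<close> of two vectors is
  the pointwise product of functions, and \<open>1\<close> is the constant function.
\<close>

definition prob_vec :: "real ^ 's \<Rightarrow> bool" where
  "prob_vec m \<longleftrightarrow> (\<forall>x. 0 \<le> m $ x) \<and> (\<Sum>x\<in>UNIV. m $ x) = 1"

definition mass :: "real ^ 's \<Rightarrow> 's set \<Rightarrow> real" where
  "mass m A = (\<Sum>x\<in>A. m $ x)"

definition expect :: "real ^ 's \<Rightarrow> real ^ 's \<Rightarrow> real" where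
  "expect m f = (\<Sum>x\<in>UNIV. f $ x * m $ x)"

definition conditioned :: "real ^ 's \<Rightarrow> 's set \<Rightarrow> real ^ 's" where
  "conditioned m A = (\<chi> x. if x \<in> A then m $ x / mass m A else 0)"

definition is_decomposition :: "'i set \<Rightarrow> ('i \<Rightarrow> 's set) \<Rightarrow> bool" where
  "is_decomposition I S \<longleftrightarrow> finite I \<and> disjoint_family_on S I \<and> (\<Union>i\<in>I. S i) = UNIV"

definition block_expect :: "real ^ 's \<Rightarrow> 'i set \<Rightarrow> ('i \<Rightarrow> 's set) \<Rightarrow> real ^ 's \<Rightarrow> real ^ 's" where
  "block_expect m I S f =
     (\<chi> x. \<Sum>i\<in>I. expect (conditioned m (S i)) f * indicator (S i) x)"

definition partition_function :: "real ^ 's \<Rightarrow> real ^ 's \<Rightarrow> real \<Rightarrow> real" where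
  "partition_function H mu t = (\<Sum>x\<in>UNIV. exp (- t * H $ x) * mu $ x)"

definition gibbs :: "real ^ 's \<Rightarrow> real ^ 's \<Rightarrow> real \<Rightarrow> real ^ 's" where
  "gibbs H mu t = (\<chi> x. exp (- t * H $ x) * mu $ x / partition_function H mu t)"

definition is_generator :: "real ^ 's ^ 's \<Rightarrow> bool" where
  "is_generator Q \<longleftrightarrow>
     (\<forall>x y. x \<noteq> y \<longrightarrow> 0 \<le> Q $ x $ y) \<and> (\<forall>x. (\<Sum>y\<in>UNIV. Q $ x $ y) = 0)"

definition detailed_balance :: "real ^ 's \<Rightarrow> real ^ 's ^ 's \<Rightarrow> bool" where
  "detailed_balance m Q \<longleftrightarrow> (\<forall>x y. m $ x * Q $ x $ y = m $ y * Q $ y $ x)"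

definition dirichlet :: "real ^ 's \<Rightarrow> real ^ 's ^ 's \<Rightarrow> real ^ 's \<Rightarrow> real ^ 's \<Rightarrow> real" where
  "dirichlet m Q f g =
     (1 / 2) * (\<Sum>x\<in>UNIV. \<Sum>y\<in>UNIV. (f $ y - f $ x) * (g $ y - g $ x) * Q $ x $ y * m $ x)"

text \<open>
  At \<open>t = s\<close> the derivative is the right derivative; nothing is required of \<open>p s t\<close> for \<open>t < s\<close>
  or \<open>s < 0\<close>.
\<close>
definition is_propagator ::
  "real ^ 's \<Rightarrow> (real \<Rightarrow> real) \<Rightarrow> (real \<Rightarrow> real ^ 's ^ 's) \<Rightarrow> (real \<Rightarrow> real \<Rightarrow> real ^ 's ^ 's) \<Rightarrow> bool"
where
  "is_propagator H M L p \<longleftrightarrow>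
     (\<forall>s\<ge>0. \<forall>f. p s s *v f = f \<and>
        (\<forall>t\<ge>s. ((\<lambda>r. p s r *v f) has_vector_derivative
                  p s t *v (M t *\<^sub>R (L t *v f) - H * f)) (at t within {s..})))"

definition nonlinear_flow ::
  "(real \<Rightarrow> real \<Rightarrow> real ^ 's ^ 's) \<Rightarrow> real \<Rightarrow> real \<Rightarrow> real ^ 's \<Rightarrow> real ^ 's" where
  "nonlinear_flow p s t nu = (1 / mass (nu v* p s t) UNIV) *\<^sub>R (nu v* p s t)"

definition rel_density :: "real ^ 's \<Rightarrow> real ^ 's \<Rightarrow> real ^ 's" where
  "rel_density nu m = (\<chi> x. nu $ x / m $ x)"

definition sq_error ::
  "real ^ 's \<Rightarrow> real ^ 's \<Rightarrow> (real \<Rightarrow> real \<Rightarrow> real ^ 's ^ 's) \<Rightarrow> real ^ 's \<Rightarrow> real \<Rightarrow> real" where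
  "sq_error H mu p nu t =
     (let g = rel_density (nonlinear_flow p 0 t nu) (gibbs H mu t)
      in expect (gibbs H mu t) ((g - 1) * (g - 1)))"

definition centred_energy ::
  "real ^ 's \<Rightarrow> real ^ 's \<Rightarrow> real \<Rightarrow> 'i set \<Rightarrow> ('i \<Rightarrow> 's set) \<Rightarrow> real ^ 's" where
  "centred_energy H mu t I S = H - block_expect (gibbs H mu t) I S H"

definition energy_gap :: "real ^ 's \<Rightarrow> real ^ 's \<Rightarrow> real \<Rightarrow> 's set \<Rightarrow> real" where
  "energy_gap H mu t A = expect (conditioned (gibbs H mu t) A) H - expect (gibbs H mu t) H"

definition neg_part :: "real \<Rightarrow> real" where
  "neg_part a = max (- a) 0"

text \<open>The quadratic form is \<open>f \<mapsto> E f f\<close>.\<close>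
definition nonneg_form :: "(real ^ 's \<Rightarrow> real ^ 's \<Rightarrow> real) \<Rightarrow> bool" where
  "nonneg_form E \<longleftrightarrow> bilinear E \<and> (\<forall>f g. E f g = E g f) \<and> (\<forall>f. 0 \<le> E f f)"

text \<open>
  A form attached to one component of the decomposition does not see the differences between the
  components: it is null on the functions that factor through the projection onto \<open>I\<close>.  For a
  non-negative form this says that \<open>E f f\<close> depends only on \<open>f\<close> modulo such functions;
  this is what allows a local Poincare inequality, stated for functions with vanishing conditional
  expectations, to be applied to the fluctuation \<open>f - block_expect m I S f\<close> of a general \<open>f\<close>.
\<close>
definition null_on_block_constants ::
  "'i set \<Rightarrow> ('i \<Rightarrow> 's set) \<Rightarrow> (real ^ 's \<Rightarrow> real ^ 's \<Rightarrow> real) \<Rightarrow> bool" where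
  "null_on_block_constants I S E \<longleftrightarrow>
     (\<forall>g. (\<forall>j\<in>I. \<forall>x\<in>S j. \<forall>y\<in>S j. g $ x = g $ y) \<longrightarrow> E g g = 0)"

text \<open>
  For forms on functions on the single components (\<open>E i f f\<close> determined by \<open>f\<close> on \<open>S i\<close>), nullity on
  block constants follows from a comparison with a Dirichlet form.
\<close>
lemma null_on_block_constants_if_local:
  fixes E :: "'i \<Rightarrow> real ^ 's \<Rightarrow> real ^ 's \<Rightarrow> real"
  assumes dec: "is_decomposition I S"
    and pos: "\<And>i. i \<in> I \<Longrightarrow> 0 < mass m (S i)"
    and form: "\<And>i. i \<in> I \<Longrightarrow> nonneg_form (E i)"
    and loc: "\<And>i f g. i \<in> I \<Longrightarrow> (\<And>x. x \<in> S i \<Longrightarrow> f $ x = g $ x) \<Longrightarrow> E i f f = E i g g"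
    and cmp: "\<And>f. (\<Sum>i\<in>I. mass m (S i) * E i f f) \<le> K * dirichlet m Q f f"
    and i: "i \<in> I"
  shows "null_on_block_constants I S (E i)"
proof -
  have bil: "bilinear (E i)" and nn: "\<And>j f. j \<in> I \<Longrightarrow> 0 \<le> E j f f"
    using form i by (auto simp: nonneg_form_def)
  have "(\<Sum>j\<in>I. mass m (S j) * E j 1 1) \<le> 0"
    using cmp[of 1] by (simp add: dirichlet_def)
  moreover have "mass m (S i) * E i 1 1 \<le> (\<Sum>j\<in>I. mass m (S j) * E j 1 1)"
  proof (rule member_le_sum[OF i])
    show "finite I" using dec by (simp add: is_decomposition_def)
    show "0 \<le> mass m (S j) * E j 1 1" if "j \<in> I - {i}" for j
      using that pos[of j] nn[of j 1] by simp
  qed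
  ultimately have "mass m (S i) * E i 1 1 \<le> 0" by linarith
  with pos[OF i] nn[OF i, of 1] have one: "E i 1 1 = 0"
    by (simp add: mult_le_0_iff)
  show ?thesis
    unfolding null_on_block_constants_def
  proof (intro allI impI)
    fix g :: "real ^ 's"
    assume g: "\<forall>j\<in>I. \<forall>x\<in>S j. \<forall>y\<in>S j. g $ x = g $ y"
    have "g $ x = g $ (SOME y. y \<in> S i)" if "x \<in> S i" for x
      using g i that someI[of "\<lambda>y. y \<in> S i" x] by blast
    then obtain c where "\<And>x. x \<in> S i \<Longrightarrow> g $ x = c"
      by blast
    then have "E i g g = E i (c *\<^sub>R 1) (c *\<^sub>R 1)"
      by (intro loc[OF i]) simp
    also have "\<dots> = 0"
      using bil one by (simp add: bilinear_lmul bilinear_rmul)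
    finally show "E i g g = 0" .
  qed
qed

end

theory Submission
  imports Defs
begin

text \<open>
  Let \<open>f = g - 1\<close>, \<open>e = E[f\<^sup>2]\<close> and \<open>G = H - E[H]\<close>.  Differentiating gives
  \<open>e' = - 2 M D(f, f) - E[G f\<^sup>2] + 2 e E[G f]\<close>, with \<open>D\<close> the Dirichlet form.
  On a block, \<open>G = G\<^sub>0 + h\<close> and \<open>f = f\<^sub>0 + a\<close> with \<open>G\<^sub>0\<close>, \<open>f\<^sub>0\<close> centred and \<open>h\<close>, \<open>a\<close> constant,
  so that, \<open>E[h]\<close> being zero, the last two terms are the block average of
  \<open>- E\<^sub>i[G\<^sub>0 f\<^sub>0\<^sup>2] - 2 (a - e) E\<^sub>i[G\<^sub>0 f\<^sub>0] - h E\<^sub>i[(f - e)\<^sup>2]\<close>.  The first of these is controlled by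
  the first local inequality, the second by the other one and AM-GM with the remaining part
  \<open>(2 M - A) D(f, f)\<close> of the Dirichlet form, the third by \<open>E[(f - e)\<^sup>2] = e + e\<^sup>2\<close>.

  The flow is well defined because the unnormalised measure \<open>v\<close> keeps positive mass: the sum of the
  squares of the negative parts of its entries satisfies \<open>q' \<le> C q\<close> with \<open>q = 0\<close> initially, so
  \<open>v \<ge> 0\<close>, and then the mass decays at rate at most \<open>max H\<close>.
\<close>

section \<open>Expectations as linear functionals\<close>

lemma expect_add: "expect m (f + g) = expect m f + expect m g"
  by (simp add: expect_def algebra_simps sum.distrib)

lemma expect_diff: "expect m (f - g) = expect m f - expect m g"
  by (simp add: expect_def algebra_simps sum_subtractf)

lemma expect_uminus: "expect m (- f) = - expect m f"
  by (simp add: expect_def sum_negf)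

lemma expect_scaleR: "expect m (c *\<^sub>R f) = c * expect m f"
  by (simp add: expect_def sum_distrib_left mult.assoc)

lemmas expect_linear = expect_add expect_diff expect_uminus expect_scaleR

lemma expect_one: "prob_vec m \<Longrightarrow> expect m 1 = 1"
  by (simp add: expect_def prob_vec_def)

lemma expect_cong: "(\<And>x. m $ x \<noteq> 0 \<Longrightarrow> f $ x = g $ x) \<Longrightarrow> expect m f = expect m g"
  unfolding expect_def by (rule sum.cong) (simp, metis mult_zero_right)

lemma expect_square_nonneg: "prob_vec m \<Longrightarrow> 0 \<le> expect m (f * f)"
  by (auto simp: expect_def prob_vec_def intro!: sum_nonneg)

lemma mass_mult_expect_conditioned:
  assumes "mass m A \<noteq> 0"
  shows "mass m A * expect (conditioned m A) f = (\<Sum>x\<in>A. f $ x * m $ x)"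
proof -
  have "expect (conditioned m A) f = (\<Sum>x\<in>A. f $ x * (m $ x / mass m A))"
    by (simp add: expect_def conditioned_def if_distrib sum.If_cases cong: if_cong)
  then show ?thesis
    using assms by (simp add: sum_distrib_left)
qed

text \<open>Nonnegativity of the variance. It is used on single blocks, to bound a squared block
  mean by a block second moment.\<close>

lemma expect_square_le:
  assumes "prob_vec m"
  shows "(expect m f)\<^sup>2 \<le> expect m (f * f)"
proof -
  have "0 \<le> expect m ((f - expect m f *\<^sub>R 1) * (f - expect m f *\<^sub>R 1))"
    using assms by (rule expect_square_nonneg)
  also have "(f - expect m f *\<^sub>R 1) * (f - expect m f *\<^sub>R 1)
      = f * f - (2 * expect m f) *\<^sub>R f + (expect m f)\<^sup>2 *\<^sub>R 1"
    by (simp add: vec_eq_iff algebra_simps power2_eq_square)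
  also have "expect m \<dots> = expect m (f * f) - (expect m f)\<^sup>2"
    by (simp add: expect_linear expect_one[OF assms] power2_eq_square)
  finally show ?thesis by simp
qed

section \<open>Non-negative quadratic forms and the Dirichlet form\<close>

lemma nonneg_form_eq_0:
  assumes "nonneg_form E" "E g g = 0"
  shows "E f g = 0"
proof (rule ccontr)
  assume *: "E f g \<noteq> 0"
  have bil: "bilinear E" and sym: "E g f = E f g"
    and nn: "0 \<le> E h h" for h
    using assms by (auto simp: nonneg_form_def)
  \<comment> \<open>Along the line \<open>f + s *\<^sub>R g\<close> the form is affine in
    \<open>s\<close>, because \<open>g\<close> is null. A nonconstant affine function takes negative
    values; this \<open>s\<close> makes it equal to -1.\<close>
  define s where "s = - (E f f + 1) / (2 * E f g)"
  have "E (f + s *\<^sub>R g) (f + s *\<^sub>R g) = E f f + 2 * s * E f g"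
    using bil sym assms(2)
    by (simp add: bilinear_ladd bilinear_radd bilinear_lmul bilinear_rmul)
  also have "\<dots> = - 1"
    using * by (simp add: s_def field_simps)
  finally show False
    using nn[of "f + s *\<^sub>R g"] by simp
qed

lemma nonneg_form_diff_null:
  assumes "nonneg_form E" "E g g = 0"
  shows "E (f - g) (f - g) = E f f"
proof -
  have "bilinear E" "E g f = 0" "E f g = 0"
    using assms nonneg_form_eq_0[OF assms, of f] by (auto simp: nonneg_form_def)
  then show ?thesis
    using assms(2) by (simp add: bilinear_lsub bilinear_rsub)
qed

lemma dirichlet_nonneg:
  assumes "is_generator Q" "\<And>x. 0 \<le> m $ x"
  shows "0 \<le> dirichlet m Q f f"
  unfolding dirichlet_def
proof (rule mult_nonneg_nonneg[OF _ sum_nonneg[OF sum_nonneg]])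
  fix x y
  \<comment> \<open>Diagonal entries of a generator may be negative, but there the increments
    vanish.\<close>
  show "0 \<le> (f $ y - f $ x) * (f $ y - f $ x) * Q $ x $ y * m $ x"
    using assms by (cases "x = y") (auto simp: is_generator_def)
qed simp

text \<open>Summation by parts. The product of increments expands into four double sums. The two in
  which both functions sit at the same point vanish: one because rows sum to zero, the other because
  detailed balance turns weighted columns into weighted rows. The two mixed sums agree after
  exchanging \<open>x\<close> and \<open>y\<close>.\<close>

lemma dirichlet_eq_expect:
  assumes gen: "is_generator Q" and db: "detailed_balance m Q"
  shows "expect m (f * (Q *v g)) = - dirichlet m Q f g"
proof -
  let ?w = "\<lambda>x y. m $ x * Q $ x $ y"
  have sym: "?w x y = ?w y x" for x y
    using db by (simp add: detailed_balance_def)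
  have row: "(\<Sum>y\<in>UNIV. c * ?w x y) = 0" for c x
    using gen by (simp add: is_generator_def flip: sum_distrib_left mult.assoc)
  have row': "(\<Sum>x\<in>UNIV. \<Sum>y\<in>UNIV. c y * ?w x y) = 0" for c
    by (subst sum.swap) (subst sym, simp add: row)
  have "2 * dirichlet m Q f g
      = (\<Sum>x\<in>UNIV. \<Sum>y\<in>UNIV. f $ y * g $ y * ?w x y - f $ y * g $ x * ?w x y
           - f $ x * g $ y * ?w x y + f $ x * g $ x * ?w x y)"
    by (simp add: dirichlet_def algebra_simps)
  also have "\<dots> = - (\<Sum>x\<in>UNIV. \<Sum>y\<in>UNIV. f $ y * g $ x * ?w x y)
      - (\<Sum>x\<in>UNIV. \<Sum>y\<in>UNIV. f $ x * g $ y * ?w x y)"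
    by (simp add: sum.distrib sum_subtractf row row')
  also have "(\<Sum>x\<in>UNIV. \<Sum>y\<in>UNIV. f $ y * g $ x * ?w x y)
      = (\<Sum>x\<in>UNIV. \<Sum>y\<in>UNIV. f $ x * g $ y * ?w x y)"
    by (subst sum.swap) (subst sym, simp)
  also have "(\<Sum>x\<in>UNIV. \<Sum>y\<in>UNIV. f $ x * g $ y * ?w x y) = expect m (f * (Q *v g))"
    by (simp add: expect_def matrix_vector_mult_def sum_distrib_left sum_distrib_right algebra_simps)
  finally show ?thesis by simp
qed

section \<open>Conditioning on the blocks of a decomposition\<close>

lemma prob_vec_conditioned:
  assumes "\<And>x. 0 \<le> m $ x" "0 < mass m A"
  shows "prob_vec (conditioned m A)"
  using assms
  by (auto simp: prob_vec_def conditioned_def mass_def sum.If_cases simp flip: sum_divide_distrib)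

lemma total_expectation:
  fixes S :: "'i \<Rightarrow> 's :: finite set"
  assumes dec: "is_decomposition I S" and pos: "\<And>i. i \<in> I \<Longrightarrow> 0 < mass m (S i)"
  shows "(\<Sum>i\<in>I. mass m (S i) * expect (conditioned m (S i)) f) = expect m f"
proof -
  have "mass m (S i) * expect (conditioned m (S i)) f = (\<Sum>x\<in>S i. f $ x * m $ x)"
    if "i \<in> I" for i
    using pos[OF that] by (simp add: mass_mult_expect_conditioned)
  then have "(\<Sum>i\<in>I. mass m (S i) * expect (conditioned m (S i)) f)
      = (\<Sum>i\<in>I. \<Sum>x\<in>S i. f $ x * m $ x)"
    by simp
  also have "\<dots> = (\<Sum>x\<in>(\<Union>i\<in>I. S i). f $ x * m $ x)"
    using dec by (subst sum.UNION_disjoint) (auto simp: is_decomposition_def disjoint_family_on_def)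
  finally show ?thesis
    using dec by (simp add: is_decomposition_def expect_def)
qed

lemma block_expect_nth:
  assumes dec: "is_decomposition I S" and "i \<in> I" "x \<in> S i"
  shows "block_expect m I S f $ x = expect (conditioned m (S i)) f"
proof -
  have "block_expect m I S f $ x
      = (\<Sum>j\<in>I. if j = i then expect (conditioned m (S i)) f else 0)"
    unfolding block_expect_def vec_lambda_beta
    using assms
    by (intro sum.cong) (auto simp: is_decomposition_def disjoint_family_on_def indicator_def)
  then show ?thesis
    using assms by (simp add: is_decomposition_def)
qed

lemma expect_conditioned_cong:
  "(\<And>x. x \<in> A \<Longrightarrow> f $ x = g $ x) \<Longrightarrow> expect (conditioned m A) f = expect (conditioned m A) g"
  by (rule expect_cong) (auto simp: conditioned_def split: if_splits)

lemma expect_conditioned_fluctuation: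
  assumes dec: "is_decomposition I S" and i: "i \<in> I"
    and nn: "\<And>x. 0 \<le> m $ x" and pos: "0 < mass m (S i)"
  shows "expect (conditioned m (S i)) (f - block_expect m I S f) = 0"
proof -
  have "expect (conditioned m (S i)) (f - block_expect m I S f)
      = expect (conditioned m (S i)) (f - expect (conditioned m (S i)) f *\<^sub>R 1)"
    using block_expect_nth[OF dec i] by (intro expect_conditioned_cong) simp
  then show ?thesis
    by (simp add: expect_linear expect_one prob_vec_conditioned nn pos)
qed

text \<open>This makes the fluctuation of any \<open>f\<close> an admissible test function in the
  local inequalities, which only concern functions with vanishing conditional expectations.\<close>

lemma block_expect_fluctuation:
  assumes "is_decomposition I S" "\<And>x. 0 \<le> m $ x" "\<And>i. i \<in> I \<Longrightarrow> 0 < mass m (S i)"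
  shows "block_expect m I S (f - block_expect m I S f) = 0"
  using expect_conditioned_fluctuation[OF assms(1) _ assms(2) assms(3)]
  by (simp add: vec_eq_iff block_expect_def[of m I S "f - block_expect m I S f"])

text \<open>Hence a local inequality tested on the fluctuation of \<open>f\<close> has the form at
  \<open>f\<close> itself on its right side, as required for the comparison with the Dirichlet form
  of \<open>f\<close>.\<close>

lemma null_on_block_constants_fluctuation:
  assumes "is_decomposition I S" "nonneg_form E" "null_on_block_constants I S E"
  shows "E (f - block_expect m I S f) (f - block_expect m I S f) = E f f"
proof (rule nonneg_form_diff_null[OF assms(2)])
  show "E (block_expect m I S f) (block_expect m I S f) = 0"
    using assms(3) block_expect_nth[OF assms(1)] by (simp add: null_on_block_constants_def)
qed

section \<open>The functional inequality at a fixed time\<close>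

lemma weighted_am_gm:
  fixes x y b c F K :: real
  assumes "y\<^sup>2 \<le> b * F" "0 < b" "0 < c" "0 < K"
  shows "- 2 * x * y \<le> x\<^sup>2 * (K * b / c) + c / K * F"
proof -
  \<comment> \<open>The weights are chosen so that, after division by \<open>K * b * c\<close>, the
    coefficient of \<open>F\<close> is \<open>c / K\<close>: averaged over the blocks, this term
    then costs at most \<open>c\<close> times the Dirichlet form.\<close>
  have "0 \<le> (x * (K * b) + c * y)\<^sup>2"
    by simp
  also have "\<dots> = x\<^sup>2 * (K * b)\<^sup>2 + 2 * x * y * (K * b * c) + c\<^sup>2 * y\<^sup>2"
    by (simp add: power2_eq_square algebra_simps)
  also have "c\<^sup>2 * y\<^sup>2 \<le> c\<^sup>2 * (b * F)"
    using assms(1) by (intro mult_left_mono) auto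
  finally have "- 2 * x * y * (K * b * c) \<le> x\<^sup>2 * (K * b)\<^sup>2 + c\<^sup>2 * (b * F)"
    by simp
  also have "\<dots> = (x\<^sup>2 * (K * b / c) + c / K * F) * (K * b * c)"
    using assms by (simp add: field_simps power2_eq_square)
  finally show ?thesis
    using assms by (meson mult_pos_pos mult_right_le_imp_le)
qed

text \<open>
  The expression on the left is the time derivative of the squared error \<open>e\<close>, for
  \<open>f = g - 1\<close>.
\<close>
lemma local_poincare_bound:
  fixes m H f :: "real ^ 's" and S :: "'i \<Rightarrow> 's set" and a b :: "'i \<Rightarrow> real"
  assumes prob: "prob_vec m"
    and gen: "is_generator Q"
    and dec: "is_decomposition I S"
    and pos: "\<And>i. i \<in> I \<Longrightarrow> 0 < mass m (S i)"
    and form: "\<And>i. i \<in> I \<Longrightarrow> nonneg_form (E i)"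
    and null: "\<And>i. i \<in> I \<Longrightarrow> null_on_block_constants I S (E i)"
    and K: "0 \<le> K"
    and cmp: "\<And>f. (\<Sum>i\<in>I. mass m (S i) * E i f f) \<le> K * dirichlet m Q f f"
    and a0: "\<And>i. i \<in> I \<Longrightarrow> 0 < a i"
    and b0: "\<And>i. i \<in> I \<Longrightarrow> 0 < b i"
    and a: "\<And>i f. i \<in> I \<Longrightarrow> block_expect m I S f = 0 \<Longrightarrow>
      expect (conditioned m (S i)) (- (H - block_expect m I S H) * (f * f)) \<le> a i * E i f f"
    and b: "\<And>i f. i \<in> I \<Longrightarrow> block_expect m I S f = 0 \<Longrightarrow>
      \<bar>expect (conditioned m (S i)) ((H - block_expect m I S H) * f)\<bar>\<^sup>2 \<le> b i * E i f f"
    and ctr: "expect m f = 0" and e: "e = expect m (f * f)"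
    and M: "K * Max (a ` I) / 2 < M"
    and h: "\<And>i. i \<in> I \<Longrightarrow> h i = expect (conditioned m (S i)) H - expect m H"
  shows "- 2 * M * dirichlet m Q f f - expect m ((H - expect m H *\<^sub>R 1) * (f * f))
      + 2 * e * expect m ((H - expect m H *\<^sub>R 1) * f)
    \<le> (K * Max (b ` I) / (2 * M - K * Max (a ` I)) + Max ((\<lambda>i. neg_part (h i)) ` I)) * (e + e\<^sup>2)"
proof -
  define w where "w i = mass m (S i)" for i
  define ex where "ex i = expect (conditioned m (S i))" for i
  define Hb where "Hb = H - expect m H *\<^sub>R 1"
  define Ht where "Ht = H - block_expect m I S H"
  define ft where "ft = f - block_expect m I S f"
  define av where "av i = ex i f" for i
  define F where "F i = E i ft ft" for i
  \<comment> \<open>The multiple of the Dirichlet form that remains after the first local inequality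
    has been paid for.\<close>
  define c where "c = 2 * M - K * Max (a ` I)"
  define y where "y i = ex i (Ht * ft)" for i
  \<comment> \<open>Centring at \<open>e\<close> completes a square:
    \<open>- Hb * f\<^sup>2 + 2 * e * Hb * f\<close> equals
    \<open>- Hb * (f - e)\<^sup>2 + e\<^sup>2 * Hb\<close>, and the last term averages to zero
    because \<open>Hb\<close> is centred.\<close>
  define v where "v i = ex i ((f - e *\<^sub>R 1) * (f - e *\<^sub>R 1))" for i
  let ?D = "dirichlet m Q f f"
  have finI: "finite I"
    using dec by (simp add: is_decomposition_def)
  \<comment> \<open>The blocks cover a nonempty type; hence the maxima over \<open>I\<close> are
    over nonempty sets.\<close>
  have "I \<noteq> {}"
    using dec by (auto simp: is_decomposition_def)
  have nn: "0 \<le> m $ x" for x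
    using prob by (simp add: prob_vec_def)
  have total: "expect m g = (\<Sum>i\<in>I. w i * ex i g)" for g
    using total_expectation[OF dec pos] by (simp add: w_def ex_def)
  have w: "0 < w i" if "i \<in> I" for i
    using pos that by (simp add: w_def)
  have cprob: "prob_vec (conditioned m (S i))" if "i \<in> I" for i
    using prob_vec_conditioned[OF nn pos[OF that]] .
  have lin: "ex i (g1 + g2) = ex i g1 + ex i g2" "ex i (g1 - g2) = ex i g1 - ex i g2"
    "ex i (- g1) = - ex i g1" "ex i (r *\<^sub>R g1) = r * ex i g1" for i g1 g2 r
    by (simp_all add: ex_def expect_linear)
  have one: "ex i 1 = 1" if "i \<in> I" for i
    using expect_one[OF cprob[OF that]] by (simp add: ex_def)
  have Ht0: "ex i Ht = 0" if "i \<in> I" for i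
    using expect_conditioned_fluctuation[OF dec that nn pos[OF that]]
    by (simp add: ex_def Ht_def)
  have bft: "block_expect m I S ft = 0"
    using block_expect_fluctuation[OF dec nn pos] by (simp add: ft_def)
  have F_eq: "F i = E i f f" if "i \<in> I" for i
    using null_on_block_constants_fluctuation[OF dec form null] that by (simp add: F_def ft_def)
  have F0: "0 \<le> F i" if "i \<in> I" for i
    using form[OF that] by (simp add: F_def nonneg_form_def)
  have sumF: "(\<Sum>i\<in>I. w i * F i) \<le> K * ?D"
    using cmp[of f] by (simp add: F_eq w_def cong: sum.cong)
  have D0: "0 \<le> ?D"
    using dirichlet_nonneg[OF gen nn] .
  have c0: "0 < c"
    using M by (simp add: c_def)
  have on_block: "Hb $ x = Ht $ x + h i" "f $ x = ft $ x + av i" if "i \<in> I" "x \<in> S i" for i x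
    using that by (simp_all add: Hb_def Ht_def ft_def av_def ex_def h block_expect_nth[OF dec])
  \<comment> \<open>Only the factor \<open>f * f\<close> next to \<open>Ht\<close> is expanded
    around the block mean \<open>av i\<close>. The term with \<open>(av i)\<^sup>2\<close> drops out
    because \<open>Ht\<close> is centred on each block.\<close>
  have split2: "ex i (Hb * (f * f)) = ex i (Ht * (ft * ft)) + 2 * av i * y i + h i * ex i (f * f)"
    if i: "i \<in> I" for i
  proof -
    have "ex i (Hb * (f * f))
        = ex i (Ht * (ft * ft) + (2 * av i) *\<^sub>R (Ht * ft) + (av i)\<^sup>2 *\<^sub>R Ht + h i *\<^sub>R (f * f))"
      unfolding ex_def
      by (rule expect_conditioned_cong) (simp add: on_block[OF i] algebra_simps power2_eq_square)
    then show ?thesis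
      using Ht0[OF i] by (simp add: lin y_def)
  qed
  have split1: "ex i (Hb * f) = y i + h i * av i" if i: "i \<in> I" for i
  proof -
    have "ex i (Hb * f) = ex i (Ht * ft + av i *\<^sub>R Ht + h i *\<^sub>R f)"
      unfolding ex_def
      by (rule expect_conditioned_cong) (simp add: on_block[OF i] algebra_simps)
    then show ?thesis
      using Ht0[OF i] by (simp add: lin y_def av_def)
  qed
  have sq: "(f - e *\<^sub>R 1) * (f - e *\<^sub>R 1) = f * f - (2 * e) *\<^sub>R f + e\<^sup>2 *\<^sub>R 1"
    by (simp add: vec_eq_iff algebra_simps power2_eq_square)
  have v_eq: "v i = ex i (f * f) - 2 * e * av i + e\<^sup>2" if "i \<in> I" for i
    using one[OF that] by (simp add: v_def sq lin av_def)
  have sumv: "(\<Sum>i\<in>I. w i * v i) = e + e\<^sup>2"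
  proof -
    have "(\<Sum>i\<in>I. w i * v i) = expect m (f * f - (2 * e) *\<^sub>R f + e\<^sup>2 *\<^sub>R 1)"
      by (simp add: v_def total flip: sq)
    then show ?thesis
      by (simp add: expect_linear expect_one[OF prob] ctr flip: e)
  qed
  have v_ge: "(av i - e)\<^sup>2 \<le> v i" if "i \<in> I" for i
    using expect_square_le[OF cprob[OF that], of "f - e *\<^sub>R 1"] one[OF that]
    by (simp add: v_def av_def lin flip: ex_def)
  have sumh: "(\<Sum>i\<in>I. w i * h i) = 0"
  proof -
    have "(\<Sum>i\<in>I. w i * h i) = (\<Sum>i\<in>I. w i * ex i (H - expect m H *\<^sub>R 1))"
      using one by (intro sum.cong) (simp_all add: h lin ex_def[symmetric])
    then show ?thesis
      by (simp add: total[symmetric] expect_linear expect_one[OF prob])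
  qed
  have bound: "- ex i (Ht * (ft * ft)) - 2 * (av i - e) * y i - h i * v i
      \<le> Max (a ` I) * F i + ((av i - e)\<^sup>2 * (K * Max (b ` I) / c) + c / K * F i)
        + Max ((\<lambda>i. neg_part (h i)) ` I) * v i"
    if i: "i \<in> I" for i
  proof -
    have "- ex i (Ht * (ft * ft)) \<le> a i * F i"
      using a[OF i bft] by (simp add: F_def ex_def flip: Ht_def expect_uminus)
    also have "\<dots> \<le> Max (a ` I) * F i"
      using i finI F0 by (intro mult_right_mono Max_ge) auto
    finally have 1: "- ex i (Ht * (ft * ft)) \<le> Max (a ` I) * F i" .
    have bm: "b i \<le> Max (b ` I)"
      using i finI by (intro Max_ge) auto
    have "(y i)\<^sup>2 \<le> b i * F i"
      using b[OF i bft] by (simp add: F_def y_def ex_def flip: Ht_def)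
    also have "\<dots> \<le> Max (b ` I) * F i"
      using bm i F0 by (intro mult_right_mono) auto
    finally have y: "(y i)\<^sup>2 \<le> Max (b ` I) * F i" .
    have 2: "- 2 * (av i - e) * y i \<le> (av i - e)\<^sup>2 * (K * Max (b ` I) / c) + c / K * F i"
    proof (cases "K = 0")
      case True
      have "w i * F i \<le> (\<Sum>i\<in>I. w i * F i)"
        using w F0 finI i by (intro member_le_sum) (auto simp: less_imp_le)
      with sumF True have "w i * F i \<le> 0" by simp
      with w[OF i] F0[OF i] have "F i = 0"
        by (simp add: mult_le_0_iff)
      with y True show ?thesis by simp
    next
      case False
      show ?thesis
        using False K bm b0[OF i] c0 by (intro weighted_am_gm[OF y]) auto
    qed
    have "- h i \<le> neg_part (h i)"
      by (simp add: neg_part_def)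
    also have "\<dots> \<le> Max ((\<lambda>i. neg_part (h i)) ` I)"
      using i finI by (intro Max_ge) auto
    finally have "- h i * v i \<le> Max ((\<lambda>i. neg_part (h i)) ` I) * v i"
      using v_ge[OF i] by (intro mult_right_mono) (auto intro: order_trans[OF zero_le_power2])
    with 1 2 show ?thesis by linarith
  qed
  have "- expect m (Hb * (f * f)) + 2 * e * expect m (Hb * f)
      = (\<Sum>i\<in>I. w i * (- ex i (Hb * (f * f)) + 2 * e * ex i (Hb * f)))"
    by (simp add: total sum_distrib_left algebra_simps sum_negf sum.distrib sum_subtractf)
  also have "\<dots> = (\<Sum>i\<in>I. w i * (- ex i (Ht * (ft * ft)) - 2 * (av i - e) * y i - h i * v i)
      + e\<^sup>2 * (w i * h i))"
    by (intro sum.cong) (simp_all add: split1 split2 v_eq algebra_simps)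
  also have "\<dots> = (\<Sum>i\<in>I. w i * (- ex i (Ht * (ft * ft)) - 2 * (av i - e) * y i - h i * v i))"
    using sumh by (simp add: sum.distrib flip: sum_distrib_left)
  also have "\<dots> \<le> (\<Sum>i\<in>I. w i * (Max (a ` I) * F i
      + ((av i - e)\<^sup>2 * (K * Max (b ` I) / c) + c / K * F i)
      + Max ((\<lambda>i. neg_part (h i)) ` I) * v i))"
    using bound w by (intro sum_mono mult_left_mono) (auto intro: less_imp_le)
  \<comment> \<open>Replacing the squared block mean by the block second moment gives both error
    terms the same factor \<open>v i\<close>, whose average is known exactly.\<close>
  also have "\<dots> \<le> (\<Sum>i\<in>I. w i * (Max (a ` I) * F i
      + (v i * (K * Max (b ` I) / c) + c / K * F i)
      + Max ((\<lambda>i. neg_part (h i)) ` I) * v i))"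
  proof (rule sum_mono)
    fix i assume i: "i \<in> I"
    have "b i \<le> Max (b ` I)"
      using i finI by (intro Max_ge) auto
    then have "0 \<le> K * Max (b ` I) / c"
      using K c0 b0[OF i] by simp
    then have "(av i - e)\<^sup>2 * (K * Max (b ` I) / c) \<le> v i * (K * Max (b ` I) / c)"
      by (rule mult_right_mono[OF v_ge[OF i]])
    then show "w i * (Max (a ` I) * F i
          + ((av i - e)\<^sup>2 * (K * Max (b ` I) / c) + c / K * F i)
          + Max ((\<lambda>i. neg_part (h i)) ` I) * v i)
        \<le> w i * (Max (a ` I) * F i
          + (v i * (K * Max (b ` I) / c) + c / K * F i)
          + Max ((\<lambda>i. neg_part (h i)) ` I) * v i)"
      by (intro mult_left_mono less_imp_le[OF w[OF i]]) simp
  qed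
  also have "\<dots> = Max (a ` I) * (\<Sum>i\<in>I. w i * F i) + c / K * (\<Sum>i\<in>I. w i * F i)
      + (K * Max (b ` I) / c + Max ((\<lambda>i. neg_part (h i)) ` I)) * (\<Sum>i\<in>I. w i * v i)"
    by (simp add: sum_distrib_left sum_divide_distrib algebra_simps sum.distrib)
  also have "\<dots> \<le> Max (a ` I) * (K * ?D) + c * ?D
      + (K * Max (b ` I) / c + Max ((\<lambda>i. neg_part (h i)) ` I)) * (e + e\<^sup>2)"
  proof -
    obtain i where "i \<in> I"
      using \<open>I \<noteq> {}\<close> by blast
    then have "0 \<le> Max (a ` I)"
      using a0 finI by (meson Max_ge finite_imageI imageI less_imp_le order_trans)
    then have "Max (a ` I) * (\<Sum>i\<in>I. w i * F i) \<le> Max (a ` I) * (K * ?D)"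
      using sumF by (intro mult_left_mono)
    moreover have "c / K * (\<Sum>i\<in>I. w i * F i) \<le> c * ?D"
      using sumF c0 K D0 by (cases "K = 0") (simp_all add: field_simps)
    ultimately show ?thesis
      by (simp add: sumv)
  qed
  \<comment> \<open>By the choice of \<open>c\<close> the two multiples of the Dirichlet form add up
    to \<open>2 * M\<close>, exactly what the left side supplies.\<close>
  also have "\<dots> = 2 * M * ?D
      + (K * Max (b ` I) / c + Max ((\<lambda>i. neg_part (h i)) ` I)) * (e + e\<^sup>2)"
    by (simp add: c_def algebra_simps)
  finally show ?thesis
    by (simp add: Hb_def c_def)
qed

section \<open>Gibbs measures and their dependence on time\<close>

lemma partition_function_pos:
  fixes mu :: "real ^ 's"
  assumes "\<And>x. 0 < mu $ x"
  shows "0 < partition_function H mu t"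
  unfolding partition_function_def using assms by (intro sum_pos) auto

lemma gibbs_pos:
  fixes mu :: "real ^ 's"
  assumes "\<And>x. 0 < mu $ x"
  shows "0 < gibbs H mu t $ x"
  using assms partition_function_pos[of mu H t, OF assms] by (simp add: gibbs_def)

lemma prob_vec_gibbs:
  fixes mu :: "real ^ 's"
  assumes "\<And>x. 0 < mu $ x"
  shows "prob_vec (gibbs H mu t)"
  using gibbs_pos[of mu, OF assms] partition_function_pos[of mu H t, OF assms]
  by (auto simp: prob_vec_def less_imp_le)
    (simp add: gibbs_def partition_function_def flip: sum_divide_distrib)

lemma gibbs_has_derivative:
  fixes mu :: "real ^ 's"
  assumes "\<And>x. 0 < mu $ x"
  shows "((\<lambda>t. gibbs H mu t $ x) has_real_derivative
    (expect (gibbs H mu t) H - H $ x) * gibbs H mu t $ x) (at t)"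
proof -
  let ?Z = "partition_function H mu"
  have Z: "?Z t \<noteq> 0"
    using partition_function_pos[of mu H t, OF assms] by simp
  have "((\<lambda>t. ?Z t) has_real_derivative - (\<Sum>x\<in>UNIV. H $ x * (exp (- t * H $ x) * mu $ x))) (at t)"
    unfolding partition_function_def
    by (auto intro!: derivative_eq_intros simp: sum_negf algebra_simps)
  also have "(\<Sum>x\<in>UNIV. H $ x * (exp (- t * H $ x) * mu $ x)) = expect (gibbs H mu t) H * ?Z t"
    using Z by (simp add: expect_def gibbs_def sum_distrib_right)
  finally have Z': "((\<lambda>t. ?Z t) has_real_derivative - (expect (gibbs H mu t) H * ?Z t)) (at t)" .
  show ?thesis
  proof -
    have "((\<lambda>t. exp (- t * H $ x) * mu $ x / ?Z t) has_real_derivative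
        (expect (gibbs H mu t) H - H $ x) * (exp (- t * H $ x) * mu $ x / ?Z t)) (at t)"
      by (rule derivative_eq_intros Z' Z refl)+ (use Z in \<open>simp add: field_simps\<close>)
    then show ?thesis
      by (simp add: gibbs_def[of H mu])
  qed
qed

text \<open>The set is held fixed while the measure moves. In the application it is a block at the
  time of differentiation, so no regularity of the decomposition in time enters.\<close>

lemma mass_gibbs_has_derivative_ln:
  fixes mu :: "real ^ 's"
  assumes mu: "\<And>x. 0 < mu $ x" and pos: "0 < mass (gibbs H mu t) A"
  shows "((\<lambda>s. ln (mass (gibbs H mu s) A)) has_real_derivative - energy_gap H mu t A) (at t)"
proof -
  let ?m = "gibbs H mu t"
  have cond: "mass ?m A * expect (conditioned ?m A) H = (\<Sum>x\<in>A. H $ x * ?m $ x)"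
    using pos by (simp add: mass_mult_expect_conditioned)
  have "((\<lambda>s. mass (gibbs H mu s) A) has_real_derivative
      (\<Sum>x\<in>A. (expect ?m H - H $ x) * ?m $ x)) (at t)"
    unfolding mass_def by (rule DERIV_sum[OF gibbs_has_derivative]) (rule mu)
  also have "(\<Sum>x\<in>A. (expect ?m H - H $ x) * ?m $ x) = - energy_gap H mu t A * mass ?m A"
  proof -
    have "(\<Sum>x\<in>A. (expect ?m H - H $ x) * ?m $ x)
        = expect ?m H * mass ?m A - mass ?m A * expect (conditioned ?m A) H"
      unfolding cond by (simp add: left_diff_distrib sum_subtractf sum_distrib_left mass_def)
    then show ?thesis
      by (simp add: energy_gap_def algebra_simps)
  qed
  finally have *: "((\<lambda>s. mass (gibbs H mu s) A) has_real_derivative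
      - energy_gap H mu t A * mass ?m A) (at t)" .
  show ?thesis
    using pos by (auto intro!: derivative_eq_intros *)
qed

section \<open>The linear evolution: positivity and mass\<close>

lemma propagated_measure_has_derivative:
  fixes H :: "real ^ 's"
  assumes p: "is_propagator H M L p" and t: "0 \<le> t"
  shows "((\<lambda>t. (nu v* p 0 t) $ y) has_real_derivative
      M t * ((nu v* p 0 t) v* L t) $ y - H $ y * (nu v* p 0 t) $ y) (at t within {0..})"
proof -
  \<comment> \<open>The propagator is given by its action on functions. Testing on the indicator of
    a point and pairing with \<open>nu\<close> yields the forward equation for one entry; the
    potential acts on this indicator as a scalar.\<close>
  let ?e = "axis y 1 :: real ^ 's"
  have "((\<lambda>r. p 0 r *v ?e) has_vector_derivative
      p 0 t *v (M t *\<^sub>R (L t *v ?e) - H * ?e)) (at t within {0..})"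
    using p t by (simp add: is_propagator_def)
  then have "((\<lambda>r. nu \<bullet> (p 0 r *v ?e)) has_vector_derivative
      nu \<bullet> (p 0 t *v (M t *\<^sub>R (L t *v ?e) - H * ?e))) (at t within {0..})"
    by (rule bounded_linear.has_vector_derivative[OF bounded_linear_inner_right])
  moreover have "H * ?e = H $ y *\<^sub>R ?e"
    by (simp add: vec_eq_iff axis_def)
  ultimately show ?thesis
    by (simp add: has_real_derivative_iff_has_vector_derivative inner_diff_right inner_axis
        flip: dot_lmul_matrix)
qed

text \<open>Squaring smooths the corner of the negative part: at 0 the two branches agree in value
  and derivative. This lets the positivity argument use ordinary derivatives.\<close>

lemma has_real_derivative_min_0_square:
  "((\<lambda>x::real. (min x 0)\<^sup>2) has_real_derivative 2 * min x 0) (at x)"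
proof -
  have "((\<lambda>x::real. if x \<in> {..0} then x\<^sup>2 else 0) has_vector_derivative
      (if x \<in> {..0} then 2 * x else 0)) (at x within UNIV)"
    by (rule has_vector_derivative_If_within_closures[where T = "{0..}"])
      (auto intro!: derivative_eq_intros
        simp flip: has_real_derivative_iff_has_vector_derivative)
  also have "(\<lambda>x::real. if x \<in> {..0} then x\<^sup>2 else 0) = (\<lambda>x. (min x 0)\<^sup>2)"
    by (auto simp: fun_eq_iff min_def)
  also have "(if x \<in> {..0} then 2 * x else 0) = 2 * min x 0"
    by (auto simp: min_def)
  finally show ?thesis
    by (simp add: has_real_derivative_iff_has_vector_derivative)
qed

text \<open>With nonnegative off-diagonal rates, a positive entry can only push other entries up, so
  negative parts are fed by negative parts alone and a Gronwall estimate keeps them at zero.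
  Diagonal entries may have any sign, which leaves room for a potential.\<close>

lemma linear_flow_nonneg:
  fixes v :: "real \<Rightarrow> real ^ 's" and Q :: "real \<Rightarrow> real ^ 's ^ 's"
  assumes deriv: "\<And>t y. 0 \<le> t \<Longrightarrow>
      ((\<lambda>t. v t $ y) has_real_derivative (v t v* Q t) $ y) (at t within {0..})"
    and cont: "continuous_on {0..} Q"
    and Q: "\<And>t x y. 0 \<le> t \<Longrightarrow> x \<noteq> y \<Longrightarrow> 0 \<le> Q t $ x $ y"
    and v0: "\<And>y. 0 \<le> v 0 $ y"
    and T: "0 \<le> T"
  shows "0 \<le> v T $ y"
proof -
  \<comment> \<open>Compactness of the time interval bounds all entries at once, so that the
    Gronwall constant does not depend on time.\<close>
  have "compact (Q ` {0..T})"
    using continuous_on_subset[OF cont] by (intro compact_continuous_image) auto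
  then obtain c where c: "\<And>t. t \<in> {0..T} \<Longrightarrow> norm (Q t) \<le> c"
    by (meson bounded_iff compact_imp_bounded imageI)
  have Qc: "\<bar>Q t $ x $ y\<bar> \<le> c" if "t \<in> {0..T}" for t x y
    using c[OF that] component_le_norm_cart[of "Q t $ x" y]
      Finite_Cartesian_Product.norm_nth_le[of "Q t" x] by linarith
  define n where "n t y = min (v t $ y) 0" for t y
  define q where "q t = (\<Sum>y\<in>UNIV. (n t y)\<^sup>2)" for t
  define q' where "q' t = (\<Sum>y\<in>UNIV. 2 * n t y * (v t v* Q t) $ y)" for t
  \<comment> \<open>Each ordered pair of states contributes \<open>c\<close> times the two squared
    negative parts, and every state occurs \<open>CARD('s)\<close> times in either position.\<close>
  define C where "C = 2 * real CARD('s) * c"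
  have q_deriv: "(q has_real_derivative q' t) (at t within {0..})" if "0 \<le> t" for t
    unfolding q_def[abs_def] q'_def n_def
    by (intro DERIV_sum DERIV_chain2[OF has_real_derivative_min_0_square] deriv that)
  have q_cont: "continuous_on {0..T} q"
  proof (rule continuous_on_subset)
    show "continuous_on {0..} q"
      using q_deriv by (intro DERIV_continuous_on[where D = q']) simp
  qed simp
  have q'_le: "q' t \<le> C * q t" if t: "t \<in> {0..T}" for t
  proof -
    have entry: "2 * n t y * (v t $ x * Q t $ x $ y) \<le> c * (n t x)\<^sup>2 + c * (n t y)\<^sup>2" for x y
    proof -
      \<comment> \<open>Replacing \<open>v\<close> by its negative part can only increase the
        product: \<open>n t y\<close> is nonpositive and off-diagonal rates are nonnegative. On the
        diagonal both sides coincide, whatever the sign of the rate.\<close>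
      have "n t y * (v t $ x * Q t $ x $ y) \<le> n t y * n t x * Q t $ x $ y"
      proof (cases "x = y")
        case True
        then show ?thesis by (simp add: n_def min_def)
      next
        case False
        then have "n t y * v t $ x \<le> n t y * n t x"
          by (intro mult_left_mono_neg) (auto simp: n_def)
        then show ?thesis
          using mult_right_mono[of _ _ "Q t $ x $ y"] Q[of t x y] False t
          by (simp flip: mult.assoc)
      qed
      also have "\<dots> \<le> \<bar>n t y * n t x\<bar> * c"
        using mult_left_mono[OF Qc[OF t, of x y], of "\<bar>n t y * n t x\<bar>"]
        by (auto simp: abs_mult intro: order_trans[OF abs_ge_self])
      finally have "2 * n t y * (v t $ x * Q t $ x $ y) \<le> c * (2 * \<bar>n t x\<bar> * \<bar>n t y\<bar>)"
        by (simp add: abs_mult mult_ac)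
      also have "\<dots> \<le> c * (\<bar>n t x\<bar>\<^sup>2 + \<bar>n t y\<bar>\<^sup>2)"
        using Qc[OF t, of x y] by (intro mult_left_mono sum_squares_bound) auto
      finally show ?thesis
        by (simp add: distrib_left)
    qed
    have "q' t = (\<Sum>y\<in>UNIV. \<Sum>x\<in>UNIV. 2 * n t y * (v t $ x * Q t $ x $ y))"
      by (simp add: q'_def vector_matrix_mult_def sum_distrib_left mult_ac)
    also have "\<dots> \<le> (\<Sum>y\<in>UNIV. \<Sum>x\<in>UNIV. c * (n t x)\<^sup>2 + c * (n t y)\<^sup>2)"
      by (intro sum_mono entry)
    also have "\<dots> = C * q t"
      by (simp add: sum.distrib C_def q_def flip: sum_distrib_left)
    finally show ?thesis .
  qed
  \<comment> \<open>Gronwall with an integrating factor. Two-sided derivatives are available only at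
    positive times; the endpoint 0 enters through continuity.\<close>
  have "exp (- C * T) * q T \<le> exp (- C * 0) * q 0"
  proof (rule DERIV_nonpos_imp_decreasing_open[OF T])
    fix t assume t: "0 < t" "t < T"
    have "(q has_real_derivative q' t) (at t)"
      using q_deriv[of t] t at_within_interior[of t "{0..}"] by simp
    then have "((\<lambda>t. exp (- C * t) * q t) has_real_derivative
        exp (- C * t) * (q' t - C * q t)) (at t)"
      by (auto intro!: derivative_eq_intros simp: algebra_simps)
    moreover have "exp (- C * t) * (q' t - C * q t) \<le> 0"
      using q'_le[of t] t by (intro mult_nonneg_nonpos) auto
    ultimately show "\<exists>y. ((\<lambda>t. exp (- C * t) * q t) has_real_derivative y) (at t) \<and> y \<le> 0"
      by blast
  qed (intro continuous_intros q_cont)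
  moreover have "q 0 = 0"
    using v0 by (simp add: q_def n_def)
  ultimately have "q T \<le> 0"
    by (simp add: mult_le_0_iff)
  moreover have "(n T y)\<^sup>2 \<le> q T"
    unfolding q_def by (rule member_le_sum) auto
  ultimately have "n T y = 0"
    by (metis order_trans power2_less_eq_zero_iff)
  then show ?thesis
    by (simp add: n_def min_def split: if_splits)
qed

text \<open>Generators annihilate constants, so the jump part conserves mass and only the potential
  removes it. Once the entries are known to be nonnegative, the rate of removal is at most the
  maximum of \<open>H\<close> times the mass.\<close>

lemma propagated_mass:
  fixes H nu :: "real ^ 's"
  assumes p: "is_propagator H M L p"
    and gen: "\<And>t. 0 \<le> t \<Longrightarrow> is_generator (L t)" and contL: "continuous_on {0..} L"
    and M: "\<And>t. 0 \<le> t \<Longrightarrow> 0 \<le> M t" and contM: "continuous_on {0..} M"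
    and nu: "prob_vec nu" and T: "0 \<le> T"
  shows "((\<lambda>t. mass (nu v* p 0 t) UNIV) has_real_derivative
           - expect (nu v* p 0 T) H) (at T within {0..})"
    and "0 < mass (nu v* p 0 T) UNIV"
proof -
  define v where "v t = nu v* p 0 t" for t
  \<comment> \<open>The potential as a diagonal matrix: subtracting it brings the forward equation
    into the form of \<open>linear_flow_nonneg\<close> and leaves the off-diagonal signs
    intact.\<close>
  define D :: "real ^ 's ^ 's" where "D = (\<chi> x y. if x = y then H $ x else 0)"
  define Q where "Q t = M t *\<^sub>R L t - D" for t
  have vD: "(u v* D) $ y = H $ y * u $ y" for u y
    by (simp add: vector_matrix_mult_def D_def if_distrib cong: if_cong)
  have vQ: "(u v* Q t) $ y = M t * (u v* L t) $ y - H $ y * u $ y" for u t y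
    unfolding vD[symmetric]
    by (simp add: vector_matrix_mult_def Q_def sum_distrib_left sum_subtractf algebra_simps)
  have v_deriv: "((\<lambda>t. v t $ y) has_real_derivative (v t v* Q t) $ y) (at t within {0..})"
    if "0 \<le> t" for t y
    using propagated_measure_has_derivative[OF p that] by (simp add: v_def vQ)
  have v0: "v 0 = nu"
  proof -
    have "v 0 \<bullet> f = nu \<bullet> f" for f
      using p by (simp add: v_def dot_lmul_matrix is_propagator_def)
    then show ?thesis
      using vector_eq_rdot by blast
  qed
  have v_nonneg: "0 \<le> v t $ y" if "0 \<le> t" for t y
  proof (rule linear_flow_nonneg[OF v_deriv _ _ _ that])
    show "continuous_on {0..} Q"
      unfolding Q_def by (intro continuous_intros contM contL)
    show "0 \<le> Q t $ x $ y" if "0 \<le> t" "x \<noteq> y" for t x y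
      using gen[OF that(1)] M[OF that(1)] that by (simp add: Q_def D_def is_generator_def)
    show "0 \<le> v 0 $ y" for y
      using nu by (simp add: v0 prob_vec_def)
  qed
  have conserve: "(\<Sum>y\<in>UNIV. (u v* L t) $ y) = 0" if "0 \<le> t" for u t
  proof -
    have "(\<Sum>y\<in>UNIV. (u v* L t) $ y) = (u v* L t) \<bullet> 1"
      by (simp add: inner_vec_def)
    also have "L t *v 1 = 0"
      using gen[OF that] by (simp add: vec_eq_iff matrix_vector_mult_def is_generator_def)
    ultimately show ?thesis
      by (simp add: dot_lmul_matrix)
  qed
  have mass_deriv: "((\<lambda>t. mass (v t) UNIV) has_real_derivative - expect (v t) H) (at t within {0..})"
    if "0 \<le> t" for t
  proof -
    have "((\<lambda>t. mass (v t) UNIV) has_real_derivative (\<Sum>y\<in>UNIV. (v t v* Q t) $ y))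
        (at t within {0..})"
      unfolding mass_def by (intro DERIV_sum v_deriv that)
    also have "(\<Sum>y\<in>UNIV. (v t v* Q t) $ y) = - expect (v t) H"
      using conserve[OF that] by (simp add: vQ sum_subtractf expect_def flip: sum_distrib_left)
    finally show ?thesis .
  qed
  show "((\<lambda>t. mass (nu v* p 0 t) UNIV) has_real_derivative
      - expect (nu v* p 0 T) H) (at T within {0..})"
    using mass_deriv[OF T] by (simp add: v_def)
  define c where "c = Max (range (\<lambda>x. H $ x))"
  have decay: "expect (v t) H \<le> c * mass (v t) UNIV" if "0 \<le> t" for t
    unfolding expect_def mass_def sum_distrib_left
    using v_nonneg[OF that] by (intro sum_mono mult_right_mono) (auto simp: c_def)
  \<comment> \<open>The compensated mass \<open>exp (c * t) * mass (v t) UNIV\<close> is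
    nondecreasing and starts at 1.\<close>
  have "exp (c * 0) * mass (v 0) UNIV \<le> exp (c * T) * mass (v T) UNIV"
  proof (rule DERIV_nonneg_imp_increasing_open[OF T])
    fix t assume t: "0 < t" "t < T"
    have "((\<lambda>t. mass (v t) UNIV) has_real_derivative - expect (v t) H) (at t)"
      using mass_deriv[of t] t at_within_interior[of t "{0..}"] by simp
    then have "((\<lambda>t. exp (c * t) * mass (v t) UNIV) has_real_derivative
        exp (c * t) * (c * mass (v t) UNIV - expect (v t) H)) (at t)"
      by (auto intro!: derivative_eq_intros simp: algebra_simps)
    moreover have "0 \<le> exp (c * t) * (c * mass (v t) UNIV - expect (v t) H)"
      using decay[of t] t by (intro mult_nonneg_nonneg) auto
    ultimately show "\<exists>y. ((\<lambda>t. exp (c * t) * mass (v t) UNIV) has_real_derivative y) (at t) \<and> 0 \<le> y"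
      by blast
  next
    have "continuous_on {0..} (\<lambda>t. mass (v t) UNIV)"
      using mass_deriv by (intro DERIV_continuous_on[where D = "\<lambda>t. - expect (v t) H"]) simp
    then show "continuous_on {0..T} (\<lambda>t. exp (c * t) * mass (v t) UNIV)"
      by (intro continuous_intros) (auto intro: continuous_on_subset)
  qed
  then have "1 \<le> exp (c * T) * mass (v T) UNIV"
    using nu by (simp add: v0 mass_def prob_vec_def)
  then show "0 < mass (nu v* p 0 T) UNIV"
    by (simp flip: v_def) (metis exp_gt_zero less_le_trans zero_less_mult_pos zero_less_one)
qed

section \<open>The normalised flow and the derivative of the squared error\<close>

lemma nonlinear_flow_has_derivative:
  fixes H nu :: "real ^ 's"
  assumes p: "is_propagator H M L p"
    and gen: "\<And>t. 0 \<le> t \<Longrightarrow> is_generator (L t)" and contL: "continuous_on {0..} L"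
    and M: "\<And>t. 0 \<le> t \<Longrightarrow> 0 \<le> M t" and contM: "continuous_on {0..} M"
    and nu: "prob_vec nu" and t: "0 < t"
  shows "((\<lambda>t. nonlinear_flow p 0 t nu $ y) has_real_derivative
      M t * (nonlinear_flow p 0 t nu v* L t) $ y
        + (expect (nonlinear_flow p 0 t nu) H - H $ y) * nonlinear_flow p 0 t nu $ y) (at t)"
proof -
  define v where "v t = nu v* p 0 t" for t
  define m where "m t = mass (v t) UNIV" for t
  note mass = propagated_mass[OF p gen contL M contM nu]
  have at: "at t within {0..} = at t"
    using t by (intro at_within_interior) simp
  have m: "0 < m t" and m': "(m has_real_derivative - expect (v t) H) (at t)"
    using mass[of t] t by (simp_all add: m_def[abs_def] v_def at)
  have v': "((\<lambda>t. v t $ y) has_real_derivative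
      M t * (v t v* L t) $ y - H $ y * v t $ y) (at t)"
    using propagated_measure_has_derivative[OF p, of t nu y] t by (simp add: v_def at)
  have flow: "nonlinear_flow p 0 t nu = (1 / m t) *\<^sub>R v t" for t
    by (simp add: nonlinear_flow_def m_def v_def)
  have e: "expect ((1 / m t) *\<^sub>R v t) H = expect (v t) H / m t"
    by (simp add: expect_def sum_divide_distrib)
  have l: "(((1 / m t) *\<^sub>R v t) v* L t) $ y = (v t v* L t) $ y / m t"
    by (simp add: vector_matrix_mult_def sum_divide_distrib mult_ac)
  \<comment> \<open>In the quotient rule the decay of the mass turns into the mean energy of the
    normalised measure, the only nonlinear term.\<close>
  have "((\<lambda>t. v t $ y / m t) has_real_derivative
      ((M t * (v t v* L t) $ y - H $ y * v t $ y) * m t - v t $ y * (- expect (v t) H))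
        / (m t * m t)) (at t)"
    using m by (intro DERIV_divide v' m') auto
  also have "((M t * (v t v* L t) $ y - H $ y * v t $ y) * m t - v t $ y * (- expect (v t) H))
        / (m t * m t)
      = M t * (((1 / m t) *\<^sub>R v t) v* L t) $ y
        + (expect ((1 / m t) *\<^sub>R v t) H - H $ y) * (v t $ y / m t)"
    unfolding e l using m by (simp add: field_simps)
  finally show ?thesis
    by (simp add: flow)
qed

lemma sum_nonlinear_flow:
  assumes "mass (nu v* p s t) UNIV \<noteq> 0"
  shows "(\<Sum>x\<in>UNIV. nonlinear_flow p s t nu $ x) = 1"
  using assms by (simp add: nonlinear_flow_def mass_def flip: sum_divide_distrib)

lemma expect_rel_density:
  assumes "\<And>x. m $ x \<noteq> 0"
  shows "expect m (f * rel_density u m) = expect u f"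
  using assms by (simp add: expect_def rel_density_def)

text \<open>Under detailed balance the forward action on a measure becomes the action on functions,
  applied to the density.\<close>

lemma detailed_balance_dual:
  assumes m: "\<And>x. m $ x \<noteq> 0" and db: "detailed_balance m Q"
  shows "(u v* Q) $ x = m $ x * (Q *v rel_density u m) $ x"
proof -
  have "Q $ y $ x * u $ y = m $ x * (Q $ x $ y * (u $ y / m $ y))" for y
  proof -
    have "Q $ y $ x * u $ y = (m $ y * Q $ y $ x) * (u $ y / m $ y)"
      using m[of y] by simp
    also have "m $ y * Q $ y $ x = m $ x * Q $ x $ y"
      using db by (simp add: detailed_balance_def)
    finally show ?thesis by simp
  qed
  then show ?thesis
    by (simp add: vector_matrix_mult_def matrix_vector_mult_def rel_density_def sum_distrib_left
        mult.commute[of "u $ _"])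
qed

text \<open>The flow and the Gibbs measure are damped by the same potential, so \<open>H\<close>
  cancels in the derivative of the density \<open>g\<close>: it equals
  \<open>M * L g + k * g\<close>, with the scalar \<open>k\<close> the difference of the two mean
  energies. The term with \<open>H\<close> and \<open>f * f\<close> comes solely from
  differentiating the weight of the outer expectation.\<close>

lemma sq_error_has_derivative:
  fixes mu nu H :: "real ^ 's"
  assumes mu: "\<And>x. 0 < mu $ x"
    and p: "is_propagator H M L p"
    and gen: "\<And>t. 0 \<le> t \<Longrightarrow> is_generator (L t)" and contL: "continuous_on {0..} L"
    and db: "detailed_balance (gibbs H mu t) (L t)"
    and M: "\<And>t. 0 \<le> t \<Longrightarrow> 0 \<le> M t" and contM: "continuous_on {0..} M"
    and nu: "prob_vec nu" and t: "0 < t"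
  defines "m \<equiv> gibbs H mu t"
  defines "f \<equiv> rel_density (nonlinear_flow p 0 t nu) m - 1"
  shows "expect m f = 0"
    and "(sq_error H mu p nu has_real_derivative
        - 2 * M t * dirichlet m (L t) f f - expect m ((H - expect m H *\<^sub>R 1) * (f * f))
          + 2 * expect m (f * f) * expect m ((H - expect m H *\<^sub>R 1) * f)) (at t)"
proof -
  define n where "n = nonlinear_flow p 0 t nu"
  define g where "g = rel_density n m"
  have m: "0 < m $ x" for x
    using gibbs_pos[of mu, OF mu] by (simp add: m_def)
  then have m0: "m $ x \<noteq> 0" for x
    using less_irrefl by metis
  have prob: "prob_vec m"
    using prob_vec_gibbs[of mu, OF mu] by (simp add: m_def)
  have g: "g = f + 1"
    by (simp add: f_def g_def n_def)
  have "0 < mass (nu v* p 0 t) UNIV"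
    using propagated_mass(2)[OF p gen contL M contM nu] t by simp
  then have "expect n 1 = 1"
    using sum_nonlinear_flow[of nu p 0 t] by (simp add: n_def expect_def)
  then have "expect m g = 1"
    using expect_rel_density[of m 1 n, OF m0] by (simp add: g_def)
  then show ctr: "expect m f = 0"
    by (simp add: g expect_linear expect_one[OF prob])
  define k where "k = expect n H - expect m H"
  \<comment> \<open>The energy difference becomes an expectation against \<open>f\<close>, linear in
    the deviation from equilibrium; multiplied by the error, it is the cubic term.\<close>
  have k: "k = expect m ((H - expect m H *\<^sub>R 1) * f)"
  proof -
    have "(H - expect m H *\<^sub>R 1) * f = H * g - H - expect m H *\<^sub>R f"
      by (simp add: g vec_eq_iff algebra_simps)
    then show ?thesis
      using expect_rel_density[of m H n, OF m0] by (simp add: expect_linear ctr k_def g_def)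
  qed
  have Lg: "L t *v g = L t *v f"
  proof -
    have "L t *v 1 = 0"
      using gen[of t] t by (simp add: vec_eq_iff matrix_vector_mult_def is_generator_def)
    then show ?thesis
      by (simp add: g matrix_vector_right_distrib)
  qed
  \<comment> \<open>The product rule for \<open>f\<^sup>2 * m\<close> at one point, with
    \<open>M * L f + k * (f + 1)\<close> as the derivative of \<open>f\<close>.\<close>
  define d where "d x = 2 * M t * (f $ x * (L t *v f) $ x * m $ x)
      + 2 * k * ((f $ x * f $ x + f $ x) * m $ x)
      - (H $ x - expect m H) * (f $ x * f $ x) * m $ x" for x
  have comp: "((\<lambda>s. (nonlinear_flow p 0 s nu $ x / gibbs H mu s $ x - 1)\<^sup>2 * gibbs H mu s $ x)
      has_real_derivative d x) (at t)" for x
  proof -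
    have n': "((\<lambda>s. nonlinear_flow p 0 s nu $ x) has_real_derivative
        M t * (m $ x * (L t *v f) $ x) + (expect n H - H $ x) * n $ x) (at t)"
      using nonlinear_flow_has_derivative[OF p gen contL M contM nu t, of x]
      unfolding n_def[symmetric]
      by (simp add: detailed_balance_dual[of m "L t" n, OF m0] db[folded m_def] Lg flip: g_def)
    have m': "((\<lambda>s. gibbs H mu s $ x) has_real_derivative (expect m H - H $ x) * m $ x) (at t)"
      using gibbs_has_derivative[of mu, OF mu] by (simp add: m_def)
    have nx: "n $ x = (f $ x + 1) * m $ x"
      using m0[of x] by (simp add: f_def n_def rel_density_def)
    have "((\<lambda>s. nonlinear_flow p 0 s nu $ x / gibbs H mu s $ x - 1) has_real_derivative
        ((M t * (m $ x * (L t *v f) $ x) + (expect n H - H $ x) * n $ x) * m $ x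
          - n $ x * ((expect m H - H $ x) * m $ x)) / (m $ x * m $ x)) (at t)"
      using DERIV_diff[OF DERIV_divide[OF n' m'] DERIV_const[of 1]] m0[of x]
      by (simp add: m_def n_def)
    also have "((M t * (m $ x * (L t *v f) $ x) + (expect n H - H $ x) * n $ x) * m $ x
          - n $ x * ((expect m H - H $ x) * m $ x)) / (m $ x * m $ x)
        = M t * (L t *v f) $ x + k * (f $ x + 1)"
      using m0[of x] by (simp add: nx k_def field_simps)
    finally have f': "((\<lambda>s. nonlinear_flow p 0 s nu $ x / gibbs H mu s $ x - 1) has_real_derivative
        M t * (L t *v f) $ x + k * (f $ x + 1)) (at t)" .
    have fx: "nonlinear_flow p 0 t nu $ x / gibbs H mu t $ x - 1 = f $ x"
      by (simp add: f_def m_def rel_density_def)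
    show ?thesis
      using DERIV_mult[OF DERIV_power[OF f', of 2] m'] unfolding fx
      by (rule DERIV_cong) (simp add: d_def algebra_simps power2_eq_square flip: m_def)
  qed
  have "sq_error H mu p nu
      = (\<lambda>s. \<Sum>x\<in>UNIV. (nonlinear_flow p 0 s nu $ x / gibbs H mu s $ x - 1)\<^sup>2 * gibbs H mu s $ x)"
    by (simp add: fun_eq_iff sq_error_def Let_def expect_def rel_density_def power2_eq_square)
  moreover have "((\<lambda>s. \<Sum>x\<in>UNIV. (nonlinear_flow p 0 s nu $ x / gibbs H mu s $ x - 1)\<^sup>2
      * gibbs H mu s $ x) has_real_derivative (\<Sum>x\<in>UNIV. d x)) (at t)"
    by (intro DERIV_sum comp)
  moreover have "(\<Sum>x\<in>UNIV. d x)
      = 2 * M t * expect m (f * (L t *v f)) + 2 * k * (expect m (f * f) + expect m f)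
        - expect m ((H - expect m H *\<^sub>R 1) * (f * f))"
    by (simp add: d_def expect_def sum.distrib sum_subtractf distrib_right flip: sum_distrib_left)
  moreover have "expect m (f * (L t *v f)) = - dirichlet m (L t) f f"
    using dirichlet_eq_expect[OF gen db] t by (simp add: m_def)
  ultimately show "(sq_error H mu p nu has_real_derivative
        - 2 * M t * dirichlet m (L t) f f - expect m ((H - expect m H *\<^sub>R 1) * (f * f))
          + 2 * expect m (f * f) * expect m ((H - expect m H *\<^sub>R 1) * f)) (at t)"
    unfolding k[symmetric] by (simp add: ctr) (simp add: algebra_simps)
qed

section \<open>The differential inequality for the logarithm of the squared error\<close>

theorem theorem8:
  fixes mu nu H :: "real ^ 's"
    and L :: "real \<Rightarrow> real ^ 's ^ 's"
    and M :: "real \<Rightarrow> real"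
    and p :: "real \<Rightarrow> real \<Rightarrow> real ^ 's ^ 's"
    and \<beta>0 :: real and \<beta>1 :: ereal and K :: real
    and J :: "real set"
    and I :: "'i set"
    and S :: "real \<Rightarrow> 'i \<Rightarrow> 's set"
    and E :: "real \<Rightarrow> 'i \<Rightarrow> real ^ 's \<Rightarrow> real ^ 's \<Rightarrow> real"
    and A B :: "real \<Rightarrow> 'i \<Rightarrow> real"
    and Ahat Bhat \<epsilon> :: "real \<Rightarrow> real"
    and \<mu> Ht :: "real \<Rightarrow> real ^ 's"
    and h :: "real \<Rightarrow> 'i \<Rightarrow> real"
  assumes "prob_vec mu" and "\<And>x. 0 < mu $ x"
    and "\<And>x. 0 \<le> H $ x"
    and "\<And>t. \<mu> t = gibbs H mu t"
    and "\<And>t. 0 \<le> t \<Longrightarrow> is_generator (L t)"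
    and "continuous_on {0..} L"
    and "\<And>t. 0 \<le> t \<Longrightarrow> detailed_balance (\<mu> t) (L t)"
    and "\<And>t. 0 \<le> t \<Longrightarrow> 0 \<le> M t"
    and "continuous_on {0..} M"
    and "is_propagator H M L p"
    and "0 \<le> \<beta>0" and "ereal \<beta>0 < \<beta>1"
    and "J = {t. \<beta>0 < t \<and> ereal t < \<beta>1}"
    and "\<And>t. t \<in> J \<Longrightarrow> is_decomposition I (S t)"
    and "\<And>t i. t \<in> J \<Longrightarrow> i \<in> I \<Longrightarrow> 0 < mass (\<mu> t) (S t i)"
    and "\<And>t i. t \<in> J \<Longrightarrow> i \<in> I \<Longrightarrow> nonneg_form (E t i)"
    and "\<And>t i. t \<in> J \<Longrightarrow> i \<in> I \<Longrightarrow> null_on_block_constants I (S t) (E t i)"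
    and "0 \<le> K"
    and "\<And>t f. t \<in> J \<Longrightarrow>
           (\<Sum>i\<in>I. mass (\<mu> t) (S t i) * E t i f f) \<le> K * dirichlet (\<mu> t) (L t) f f"
    and "\<And>t. Ht t = centred_energy H mu t I (S t)"
    and "\<And>t i. t \<in> J \<Longrightarrow> i \<in> I \<Longrightarrow> 0 < A t i"
    and "\<And>t i. t \<in> J \<Longrightarrow> i \<in> I \<Longrightarrow> 0 < B t i"
    and "\<And>t i f. t \<in> J \<Longrightarrow> i \<in> I \<Longrightarrow> block_expect (\<mu> t) I (S t) f = 0 \<Longrightarrow>
           expect (conditioned (\<mu> t) (S t i)) (- Ht t * (f * f)) \<le> A t i * E t i f f"
    and "\<And>t i f. t \<in> J \<Longrightarrow> i \<in> I \<Longrightarrow> block_expect (\<mu> t) I (S t) f = 0 \<Longrightarrow>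
           \<bar>expect (conditioned (\<mu> t) (S t i)) (Ht t * f)\<bar>\<^sup>2 \<le> B t i * E t i f f"
    and "\<And>t. Ahat t = K * Max ((\<lambda>i. A t i) ` I)"
    and "\<And>t. Bhat t = K * Max ((\<lambda>i. B t i) ` I)"
    and "prob_vec nu"
    and "\<And>t. \<epsilon> t = sq_error H mu p nu t"
    and "\<And>t i. h t i = energy_gap H mu t (S t i)"
    and "\<And>t. t \<in> J \<Longrightarrow> Ahat t / 2 < M t"
  shows "\<forall>t\<in>J.
     (\<forall>i\<in>I. ((\<lambda>s. ln (mass (\<mu> s) (S t i))) has_real_derivative - h t i) (at t)) \<and>
     (0 < \<epsilon> t \<longrightarrow>
        (\<exists>D. ((\<lambda>s. ln (\<epsilon> s)) has_real_derivative D) (at t) \<and>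
             D \<le> Bhat t / (M t - Ahat t / 2) * (1 + \<epsilon> t)
                 + (1 + sqrt (\<epsilon> t))\<^sup>2 * Max ((\<lambda>i. neg_part (h t i)) ` I)))"
proof (intro ballI conjI impI)
  fix t assume t: "t \<in> J"
  have t0: "0 < t"
    using t assms(11,13) by simp
  have \<mu>: "\<mu> = gibbs H mu"
    using assms(4) by blast
  show "((\<lambda>s. ln (mass (\<mu> s) (S t i))) has_real_derivative - h t i) (at t)" if "i \<in> I" for i
    using mass_gibbs_has_derivative_ln[of mu H t "S t i", OF assms(2)] assms(15)[OF t that]
    by (simp add: \<mu> assms(29))
  \<comment> \<open>The logarithmic derivative only makes sense where the error is positive.\<close>
  assume e0: "0 < \<epsilon> t"
  define f where "f = rel_density (nonlinear_flow p 0 t nu) (\<mu> t) - 1"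
  define e' where "e' = - 2 * M t * dirichlet (\<mu> t) (L t) f f
      - expect (\<mu> t) ((H - expect (\<mu> t) H *\<^sub>R 1) * (f * f))
      + 2 * \<epsilon> t * expect (\<mu> t) ((H - expect (\<mu> t) H *\<^sub>R 1) * f)"
  define c where "c = 2 * M t - Ahat t"
  define hm where "hm = Max ((\<lambda>i. neg_part (h t i)) ` I)"
  have e: "\<epsilon> t = expect (\<mu> t) (f * f)"
    by (simp add: assms(28) sq_error_def Let_def f_def \<mu>)
  have db: "detailed_balance (gibbs H mu t) (L t)"
    using assms(7)[of t] t0 by (simp add: \<mu>)
  note deriv = sq_error_has_derivative[of mu H M L p t nu, OF assms(2,10,5,6) db assms(8,9,27) t0,
      folded \<mu>, folded f_def, folded e]
  have "\<epsilon> = sq_error H mu p nu"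
    using assms(28) by blast
  then have e_deriv: "(\<epsilon> has_real_derivative e') (at t)"
    using deriv(2) by (simp add: e'_def)
  have finI: "finite I" and "I \<noteq> {}"
    using assms(14)[OF t] by (auto simp: is_decomposition_def)
  then obtain i where i: "i \<in> I"
    by blast
  have "0 \<le> neg_part (h t i)"
    by (simp add: neg_part_def)
  also have "\<dots> \<le> hm"
    unfolding hm_def using i finI by (intro Max_ge) auto
  finally have hm: "0 \<le> hm" .
  have "0 < B t i"
    using assms(22)[OF t i] .
  also have "\<dots> \<le> Max (B t ` I)"
    using i finI by (intro Max_ge) auto
  finally have Bhat: "0 \<le> Bhat t"
    using assms(18) by (simp add: assms(26))
  have c: "0 < c"
    using assms(30)[OF t] by (simp add: c_def)
  have "e' \<le> (K * Max (B t ` I) / (2 * M t - K * Max (A t ` I))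
      + Max ((\<lambda>i. neg_part (h t i)) ` I)) * (\<epsilon> t + (\<epsilon> t)\<^sup>2)"
    unfolding e'_def
  proof (rule local_poincare_bound[where S = "S t" and E = "E t"])
    show "prob_vec (\<mu> t)"
      using prob_vec_gibbs[of mu, OF assms(2)] by (simp add: \<mu>)
    show "is_generator (L t)"
      using assms(5) t0 by simp
    show "expect (conditioned (\<mu> t) (S t i)) (- (H - block_expect (\<mu> t) I (S t) H) * (f * f))
        \<le> A t i * E t i f f"
      if "i \<in> I" "block_expect (\<mu> t) I (S t) f = 0" for i f
      using assms(23)[OF t that] by (simp add: assms(20) centred_energy_def \<mu>)
    show "\<bar>expect (conditioned (\<mu> t) (S t i)) ((H - block_expect (\<mu> t) I (S t) H) * f)\<bar>\<^sup>2
        \<le> B t i * E t i f f"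
      if "i \<in> I" "block_expect (\<mu> t) I (S t) f = 0" for i f
      using assms(24)[OF t that] by (simp add: assms(20) centred_energy_def \<mu>)
    show "K * Max (A t ` I) / 2 < M t"
      using assms(30)[OF t] by (simp add: assms(25))
    show "h t i = expect (conditioned (\<mu> t) (S t i)) H - expect (\<mu> t) H" for i
      by (simp add: assms(29) energy_gap_def \<mu>)
  qed (rule assms(14-17,19,21,22)[OF t] assms(18) deriv(1) e; assumption)+
  then have "e' \<le> (Bhat t / c + hm) * (\<epsilon> t + (\<epsilon> t)\<^sup>2)"
    by (simp add: assms(25,26) c_def hm_def)
  \<comment> \<open>The factor split off here is the one by which the logarithmic derivative
    divides.\<close>
  also have "\<epsilon> t + (\<epsilon> t)\<^sup>2 = (1 + \<epsilon> t) * \<epsilon> t"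
    by (simp add: power2_eq_square algebra_simps)
  finally have "e' / \<epsilon> t \<le> Bhat t / c * (1 + \<epsilon> t) + (1 + \<epsilon> t) * hm"
    using e0 by (simp add: pos_divide_le_eq algebra_simps add_divide_distrib)
  \<comment> \<open>Both coefficients have slack: \<open>c\<close> is twice
    \<open>M t - Ahat t / 2\<close>, and \<open>(1 + sqrt (\<epsilon> t))\<^sup>2\<close> exceeds
    \<open>1 + \<epsilon> t\<close> by \<open>2 * sqrt (\<epsilon> t)\<close>.\<close>
  also have "\<dots> \<le> Bhat t / (M t - Ahat t / 2) * (1 + \<epsilon> t) + (1 + sqrt (\<epsilon> t))\<^sup>2 * hm"
  proof (intro add_mono mult_right_mono hm)
    show "Bhat t / c \<le> Bhat t / (M t - Ahat t / 2)"
      using Bhat c by (intro divide_left_mono) (auto simp: c_def)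
    show "1 + \<epsilon> t \<le> (1 + sqrt (\<epsilon> t))\<^sup>2"
      using e0 by (simp add: power2_sum)
  qed (use e0 in simp)
  finally have "e' / \<epsilon> t
      \<le> Bhat t / (M t - Ahat t / 2) * (1 + \<epsilon> t) + (1 + sqrt (\<epsilon> t))\<^sup>2 * hm" .
  moreover have "((\<lambda>s. ln (\<epsilon> s)) has_real_derivative e' / \<epsilon> t) (at t)"
    using DERIV_chain2[OF DERIV_ln_divide[OF e0] e_deriv] by simp
  ultimately show "\<exists>D. ((\<lambda>s. ln (\<epsilon> s)) has_real_derivative D) (at t) \<and>
      D \<le> Bhat t / (M t - Ahat t / 2) * (1 + \<epsilon> t)
        + (1 + sqrt (\<epsilon> t))\<^sup>2 * Max ((\<lambda>i. neg_part (h t i)) ` I)"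
    unfolding hm_def by blast
qed

end
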